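(* Let $\mathbf R=(R,\oplus,\cdot,0,1)$ be an algebra of type $(2,2,0,0)$. Define $x':=x\oplus 1$, $x\vee y:=(x'y')'$, $x\wedge y:=xy$, and $\mathbb L(\mathbf R):=(R,\vee,\wedge,{}',0,1)$. Then $\mathbf R$ is a ring-like structure of events (RLSE) if and only if $\mathbb L(\mathbf R)$ is an orthomodular lattice and $\oplus$ satisfies: (i) $x\oplus y=y\oplus x$ for all $x,y$; (ii) $x\oplus 1=x'$ for all $x$; (iii) $x\oplus y=x\vee y$ for all $x,y\in R$ with $x\le y'$ (where $\le$ is the partial order induced by the meet-semilattice $(R,\cdot)$, i.e. $x\le y$ iff $xy=x$).
   Context: A ring-like structure of events (RLSE) is an algebra $(R,\oplus,\cdot,0,1)$ of type $(2,2,0,0)$ such that $(R,\cdot,1)$ is an idempotent commutative monoid with zero element $0$ (i.e. $x0=0$ for all $x$), satisfying the identities (R1) $x\oplus y= y\oplus x$; (R2) $(xy\oplus1)(x\oplus1)\oplus1= x$; (R3) $((xy\oplus1)x\oplus1)x= xy$; (R4) $xy\oplus(x\oplus1)=(xy\oplus1)x\oplus1$. *)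

theory Defs
  imports "HOL-Library.Complemented_Lattices"
begin

text \<open>An algebra of type (2,2,0,0) is given by its operations on a type, the type being the
  universe. The locale \<open>semilattice_neutr\<close> of Main is precisely an idempotent commutative
  monoid.\<close>

locale rlse =
  semilattice_neutr mult one
  for oplus :: "'a \<Rightarrow> 'a \<Rightarrow> 'a"  (infixl "\<oplus>" 65)
    and mult :: "'a \<Rightarrow> 'a \<Rightarrow> 'a"  (infixl "\<cdot>" 70)
    and zero :: 'a  ("\<zero>")
    and one :: 'a  ("\<one>") +
  assumes mult_zero: "x \<cdot> \<zero> = \<zero>"
    and R1: "x \<oplus> y = y \<oplus> x"
    and R2: "(x \<cdot> y \<oplus> \<one>) \<cdot> (x \<oplus> \<one>) \<oplus> \<one> = x"
    and R3: "((x \<cdot> y \<oplus> \<one>) \<cdot> x \<oplus> \<one>) \<cdot> x = x \<cdot> y"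
    and R4: "x \<cdot> y \<oplus> (x \<oplus> \<one>) = (x \<cdot> y \<oplus> \<one>) \<cdot> x \<oplus> \<one>"

definition meet_le :: "('a \<Rightarrow> 'a \<Rightarrow> 'a) \<Rightarrow> 'a \<Rightarrow> 'a \<Rightarrow> bool" where
  "meet_le meet x y \<longleftrightarrow> meet x y = x"

text \<open>The library class, as a predicate on algebras \<open>(L, \<or>, \<and>, ', 0, 1)\<close>. The class has the order
  and a difference operation among its parameters; the order is the one induced by the meet, and
  for the difference we insert the value \<open>x \<and> y'\<close> that the class axiom \<open>diff_eq\<close> prescribes, so
  that this axiom imposes nothing.\<close>

definition orthomodular_lattice_algebra ::
  "('a \<Rightarrow> 'a \<Rightarrow> 'a) \<Rightarrow> ('a \<Rightarrow> 'a \<Rightarrow> 'a) \<Rightarrow> ('a \<Rightarrow> 'a) \<Rightarrow> 'a \<Rightarrow> 'a \<Rightarrow> bool" where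
  "orthomodular_lattice_algebra join meet compl zero one \<longleftrightarrow>
     class.orthomodular_lattice (\<lambda>x y. meet x (compl y)) compl
       meet (meet_le meet) (\<lambda>x y. meet_le meet x y \<and> x \<noteq> y) join zero one"

definition ring_compl :: "('a \<Rightarrow> 'a \<Rightarrow> 'a) \<Rightarrow> 'a \<Rightarrow> 'a \<Rightarrow> 'a" where
  "ring_compl oplus one x = oplus x one"

definition ring_join ::
  "('a \<Rightarrow> 'a \<Rightarrow> 'a) \<Rightarrow> ('a \<Rightarrow> 'a \<Rightarrow> 'a) \<Rightarrow> 'a \<Rightarrow> 'a \<Rightarrow> 'a \<Rightarrow> 'a" where
  "ring_join oplus mult one x y =
     ring_compl oplus one (mult (ring_compl oplus one x) (ring_compl oplus one y))"

end

theory Submission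
  imports Defs
begin

text \<open>Write \<open>x'\<close> for \<open>x \<oplus> 1\<close>. Axiom (R2) with \<open>y = 1\<close> says that \<open>'\<close> is an involution, and then (R2)
  says that it is antitone, so that \<open>\<or>\<close> is the join by De Morgan. Axiom (R3) is the dual orthomodular
  law \<open>(z \<or> x') \<and> x = z\<close> for \<open>z \<le> x\<close>, with \<open>z = x y\<close>; for \<open>y = 0\<close> it gives \<open>x' x = 0\<close>. Finally,
  (R4) says \<open>z \<oplus> x' = z \<or> x'\<close> for \<open>z \<le> x\<close>, which is condition (iii).\<close>

context rlse
begin

abbreviation compl :: "'a \<Rightarrow> 'a"  ("_\<^sup>\<bottom>" [1000] 1000) where
  "x\<^sup>\<bottom> \<equiv> x \<oplus> \<one>"

lemma compl_compl [simp]: "x\<^sup>\<bottom>\<^sup>\<bottom> = x"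
  using R2[of x \<one>] by simp

lemma compl_antimono:
  assumes "x \<cdot> y = x"
  shows "y\<^sup>\<bottom> \<cdot> x\<^sup>\<bottom> = y\<^sup>\<bottom>"
proof -
  have "(x\<^sup>\<bottom> \<cdot> y\<^sup>\<bottom>)\<^sup>\<bottom> = y"
    using R2[of y x] assms by (simp add: commute)
  then show ?thesis
    by (metis commute compl_compl)
qed

text \<open>Since 0' lies below 1, antitonicity together with the involution puts 1' below 0'' = 0,
  and \<open>mult_zero\<close> forces 1' = 0.\<close>

lemma compl_one [simp]: "\<one>\<^sup>\<bottom> = \<zero>"
  using compl_antimono[of "\<zero>\<^sup>\<bottom>" \<one>] by (simp add: mult_zero)

lemma compl_zero [simp]: "\<zero>\<^sup>\<bottom> = \<one>"
  using compl_compl[of \<one>] by simp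

lemma mult_compl: "x \<cdot> x\<^sup>\<bottom> = \<zero>"
  using R3[of x \<zero>] by (simp add: mult_zero commute)

lemma orthomodular_dual:
  assumes "z \<cdot> x = z"
  shows "(z\<^sup>\<bottom> \<cdot> x)\<^sup>\<bottom> \<cdot> x = z"
  using R3[of x z] assms by (simp add: commute)

text \<open>For x below y, the dual law is applied to y' below x'; complementing the result gives
  the law in its usual form.\<close>

lemma orthomodular:
  assumes "x \<cdot> y = x"
  shows "(x\<^sup>\<bottom> \<cdot> (x\<^sup>\<bottom> \<cdot> y)\<^sup>\<bottom>)\<^sup>\<bottom> = y"
  using orthomodular_dual[OF compl_antimono[OF assms]] by (simp add: commute)

text \<open>The instance of (R4) at y' and x: here y' x = x by assumption, and y'' = y turns the
  second summand into y.\<close>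

lemma oplus_eq_join:
  assumes "x \<cdot> y\<^sup>\<bottom> = x"
  shows "x \<oplus> y = (x\<^sup>\<bottom> \<cdot> y\<^sup>\<bottom>)\<^sup>\<bottom>"
  using R4[of "y\<^sup>\<bottom>" x] assms by (simp add: commute)

lemma orthomodular_lattice_algebra:
  "orthomodular_lattice_algebra (ring_join (\<oplus>) (\<cdot>) \<one>) (\<cdot>) (ring_compl (\<oplus>) \<one>) \<zero> \<one>"
  unfolding orthomodular_lattice_algebra_def
proof (unfold_locales, unfold meet_le_def ring_join_def ring_compl_def)
  fix x y z
  show "(x \<cdot> y = x \<and> x \<noteq> y) = (x \<cdot> y = x \<and> \<not> y \<cdot> x = y)"
    by (metis commute)
  show "x \<cdot> x = x" by simp
  show "x \<cdot> y = x \<Longrightarrow> y \<cdot> z = y \<Longrightarrow> x \<cdot> z = x"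
    by (metis assoc)
  show "x \<cdot> y = x \<Longrightarrow> y \<cdot> x = y \<Longrightarrow> x = y"
    by (metis commute)
  show "x \<cdot> y \<cdot> x = x \<cdot> y" "x \<cdot> y \<cdot> y = x \<cdot> y"
    by (simp_all add: ac_simps)
  show "x \<cdot> y = x \<Longrightarrow> x \<cdot> z = x \<Longrightarrow> x \<cdot> (y \<cdot> z) = x"
    by (metis assoc)
  \<comment> \<open>The meet x' y' is below x' and below y'; complementing both inequalities makes
    its complement an upper bound of x and y.\<close>
  show "x \<cdot> (x\<^sup>\<bottom> \<cdot> y\<^sup>\<bottom>)\<^sup>\<bottom> = x" "y \<cdot> (x\<^sup>\<bottom> \<cdot> y\<^sup>\<bottom>)\<^sup>\<bottom> = y"
    using compl_antimono[of "x\<^sup>\<bottom> \<cdot> y\<^sup>\<bottom>" "x\<^sup>\<bottom>"] compl_antimono[of "x\<^sup>\<bottom> \<cdot> y\<^sup>\<bottom>" "y\<^sup>\<bottom>"]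
    by (simp_all add: ac_simps)
  \<comment> \<open>Least upper bound by duality: x' is a lower bound of y' and z', hence below
    their meet, and complementing reverses this.\<close>
  show "(y\<^sup>\<bottom> \<cdot> z\<^sup>\<bottom>)\<^sup>\<bottom> \<cdot> x = (y\<^sup>\<bottom> \<cdot> z\<^sup>\<bottom>)\<^sup>\<bottom>" if "y \<cdot> x = y" "z \<cdot> x = z"
  proof -
    have "x\<^sup>\<bottom> \<cdot> (y\<^sup>\<bottom> \<cdot> z\<^sup>\<bottom>) = x\<^sup>\<bottom>"
      using compl_antimono that by (metis assoc)
    then show ?thesis
      using compl_antimono[of "x\<^sup>\<bottom>"] by (metis compl_compl)
  qed
  show "\<zero> \<cdot> x = \<zero>"
    by (metis commute mult_zero)
  show "x \<cdot> \<one> = x" by simp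
  show "x \<cdot> x\<^sup>\<bottom> = \<zero>"
    by (rule mult_compl)
  show "(x\<^sup>\<bottom> \<cdot> x\<^sup>\<bottom>\<^sup>\<bottom>)\<^sup>\<bottom> = \<one>"
    by (simp only: mult_compl compl_zero)
  show "x \<cdot> y\<^sup>\<bottom> = x \<cdot> y\<^sup>\<bottom>" ..
  show "x\<^sup>\<bottom>\<^sup>\<bottom> = x" by simp
  show "x \<cdot> y = x \<Longrightarrow> y\<^sup>\<bottom> \<cdot> x\<^sup>\<bottom> = y\<^sup>\<bottom>"
    by (rule compl_antimono)
  show "x \<cdot> y = x \<Longrightarrow> (x\<^sup>\<bottom> \<cdot> (x\<^sup>\<bottom> \<cdot> y)\<^sup>\<bottom>)\<^sup>\<bottom> = y"
    by (rule orthomodular)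
qed

end

text \<open>Each axiom is read back as a lattice law: (R2) is the absorption x y \<or> x = x, (R3)
  comes from orthomodularity, and (R4) from condition (iii).\<close>

lemma rlse_if_orthomodular_lattice_algebra:
  fixes oplus mult :: "'a \<Rightarrow> 'a \<Rightarrow> 'a" and zero one :: 'a
  assumes oml: "orthomodular_lattice_algebra
      (ring_join oplus mult one) mult (ring_compl oplus one) zero one"
    and oplus_commute: "\<And>x y. oplus x y = oplus y x"
    and oplus_eq_join: "\<And>x y. meet_le mult x (ring_compl oplus one y) \<Longrightarrow>
      oplus x y = ring_join oplus mult one x y"
  shows "rlse oplus mult zero one"
proof -
  let ?c = "ring_compl oplus one"
  interpret L: orthomodular_lattice "\<lambda>x y. mult x (?c y)" ?c mult "meet_le mult"
    "\<lambda>x y. meet_le mult x y \<and> x \<noteq> y" "ring_join oplus mult one" zero one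
    using oml by (simp add: orthomodular_lattice_algebra_def)
  have oplus_one: "oplus x one = ?c x" for x
    by (rule ring_compl_def[symmetric])
  have join: "ring_join oplus mult one x y = ?c (mult (?c x) (?c y))" for x y
    by (rule ring_join_def)
  show ?thesis
  proof (unfold_locales, unfold oplus_one)
    fix x y
    show "mult x zero = zero" by (rule L.inf_bot_right)
    show "oplus x y = oplus y x" by (rule oplus_commute)
    show "?c (mult (?c (mult x y)) (?c x)) = x"
      unfolding join[symmetric] by (simp add: L.sup_absorb2)
    show "mult (?c (mult (?c (mult x y)) x)) x = mult x y"
    proof -
      \<comment> \<open>The orthomodular law for x' below (x y)', complemented on both sides; De
        Morgan then yields (R3).\<close>
      have "?c (ring_join oplus mult one (?c x) (mult x (?c (mult x y)))) = mult x y"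
        using L.orthomodular[of "?c x" "?c (mult x y)"]
        by (metis L.compl_mono L.inf_le1 L.ortho_involution)
      then show ?thesis
        by (metis L.compl_sup L.inf_commute L.ortho_involution)
    qed
    \<comment> \<open>Condition (iii) applies to x y and x', because x y lies below x = x''.\<close>
    show "oplus (mult x y) (?c x) = ?c (mult (?c (mult x y)) x)"
      by (metis oplus_eq_join join L.inf_le1 L.ortho_involution)
  qed
qed

theorem theorem2p1:
  fixes oplus mult :: "'a \<Rightarrow> 'a \<Rightarrow> 'a" and zero one :: 'a
  shows "rlse oplus mult zero one \<longleftrightarrow>
    orthomodular_lattice_algebra (ring_join oplus mult one) mult (ring_compl oplus one) zero one
    \<and> (\<forall>x y. oplus x y = oplus y x)
    \<and> (\<forall>x. oplus x one = ring_compl oplus one x)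
    \<and> (\<forall>x y. meet_le mult x (ring_compl oplus one y) \<longrightarrow>
          oplus x y = ring_join oplus mult one x y)"
proof
  assume "rlse oplus mult zero one"
  then interpret rlse oplus mult zero one .
  show "orthomodular_lattice_algebra (ring_join oplus mult one) mult (ring_compl oplus one) zero one
    \<and> (\<forall>x y. oplus x y = oplus y x)
    \<and> (\<forall>x. oplus x one = ring_compl oplus one x)
    \<and> (\<forall>x y. meet_le mult x (ring_compl oplus one y) \<longrightarrow>
          oplus x y = ring_join oplus mult one x y)"
    using orthomodular_lattice_algebra R1 oplus_eq_join
    by (simp add: meet_le_def ring_join_def ring_compl_def)
qed (blast intro: rlse_if_orthomodular_lattice_algebra)

end
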